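(* Let $\Omega$ be an infinite set. Then an element $h \in \mathrm{Inj}(\Omega)$ can be expressed in the form $h = afa^{-1}bfb^{-1}$, for some $f \in \mathrm{Inj}(\Omega)$ and $a, b \in \mathrm{Sym}(\Omega)$, if and only if $|\Omega \setminus (\Omega)h|$ is either an even integer or infinite.
   Context: $\mathrm{Inj}(\Omega)$ is the monoid of all injective maps $\Omega \to \Omega$, and $\mathrm{Sym}(\Omega)$ is the group of all permutations of $\Omega$. Maps are written on the right of their arguments, so $(\alpha)fg = ((\alpha)f)g$, and $(\Omega)h$ denotes the image of $h$. $|\cdot|$ denotes cardinality (and $0$ counts as an even integer). *)

theory Defs
  imports "HOL-Algebra.Bij"
begin

text \<open>
  The monoid of all injective maps \<open>\<Omega> \<rightarrow> \<Omega>\<close>. Maps are written on the right of their arguments, so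
  \<open>f \<otimes> g\<close> applies \<open>f\<close> first. A map on \<open>\<Omega>\<close> is represented by its extensional representative
  (\<open>undefined\<close> outside \<open>\<Omega>\<close>), so that equality in the monoid is equality of maps on \<open>\<Omega>\<close>.
  The symmetric group of \<open>\<Omega>\<close> has the library's \<open>Bij \<Omega>\<close> as its underlying set; by \<open>Units_Inj\<close> it is
  the set of units of the monoid, so the monoid inverse of a permutation is meaningful, and by
  \<open>inv_Inj\<close> it is the inverse map.
\<close>

definition Inj :: "'a set \<Rightarrow> ('a \<Rightarrow> 'a) monoid" where
  "Inj \<Omega> = \<lparr>carrier = {f \<in> \<Omega> \<rightarrow>\<^sub>E \<Omega>. inj_on f \<Omega>},
            mult = (\<lambda>f g. compose \<Omega> g f),
            one = (\<lambda>x\<in>\<Omega>. x)\<rparr>"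

lemma carrier_Inj: "carrier (Inj \<Omega>) = {f \<in> \<Omega> \<rightarrow>\<^sub>E \<Omega>. inj_on f \<Omega>}"
  and mult_Inj: "f \<otimes>\<^bsub>Inj \<Omega>\<^esub> g = compose \<Omega> g f"
  and one_Inj: "\<one>\<^bsub>Inj \<Omega>\<^esub> = (\<lambda>x\<in>\<Omega>. x)"
  by (simp_all add: Inj_def)

lemma monoid_Inj: "monoid (Inj \<Omega>)"
proof (rule monoidI)
  fix f g assume f: "f \<in> carrier (Inj \<Omega>)" and g: "g \<in> carrier (Inj \<Omega>)"
  have "inj_on (compose \<Omega> g f) \<Omega>"
    using f g by (simp add: carrier_Inj inj_on_def compose_eq) (metis PiE_mem)
  then show "f \<otimes>\<^bsub>Inj \<Omega>\<^esub> g \<in> carrier (Inj \<Omega>)"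
    using f g by (simp add: carrier_Inj mult_Inj PiE_def funcset_compose[of f \<Omega> \<Omega>])
next
  fix f g k
  assume "f \<in> carrier (Inj \<Omega>)"
  then show "f \<otimes>\<^bsub>Inj \<Omega>\<^esub> g \<otimes>\<^bsub>Inj \<Omega>\<^esub> k = f \<otimes>\<^bsub>Inj \<Omega>\<^esub> (g \<otimes>\<^bsub>Inj \<Omega>\<^esub> k)"
    by (simp add: carrier_Inj mult_Inj PiE_def compose_assoc)
next
  fix f assume "f \<in> carrier (Inj \<Omega>)"
  then have "f \<in> \<Omega> \<rightarrow> \<Omega>" "f \<in> extensional \<Omega>"
    by (simp_all add: carrier_Inj PiE_def)
  then show "\<one>\<^bsub>Inj \<Omega>\<^esub> \<otimes>\<^bsub>Inj \<Omega>\<^esub> f = f" "f \<otimes>\<^bsub>Inj \<Omega>\<^esub> \<one>\<^bsub>Inj \<Omega>\<^esub> = f"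
    unfolding mult_Inj one_Inj by (rule compose_Id, rule Id_compose)
qed (simp add: carrier_Inj one_Inj inj_on_def)

lemma Bij_inverse_Inj:
  assumes "a \<in> Bij \<Omega>"
  shows "a \<in> carrier (Inj \<Omega>)" "(\<lambda>x\<in>\<Omega>. inv_into \<Omega> a x) \<in> carrier (Inj \<Omega>)"
    and "a \<otimes>\<^bsub>Inj \<Omega>\<^esub> (\<lambda>x\<in>\<Omega>. inv_into \<Omega> a x) = \<one>\<^bsub>Inj \<Omega>\<^esub>"
    and "(\<lambda>x\<in>\<Omega>. inv_into \<Omega> a x) \<otimes>\<^bsub>Inj \<Omega>\<^esub> a = \<one>\<^bsub>Inj \<Omega>\<^esub>"
proof -
  have Bij_sub: "c \<in> carrier (Inj \<Omega>)" if "c \<in> Bij \<Omega>" for c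
    using that by (auto simp: Bij_def carrier_Inj bij_betw_def PiE_iff)
  show "a \<in> carrier (Inj \<Omega>)" "(\<lambda>x\<in>\<Omega>. inv_into \<Omega> a x) \<in> carrier (Inj \<Omega>)"
    using assms restrict_inv_into_Bij by (auto intro: Bij_sub)
  have "bij_betw a \<Omega> \<Omega>"
    using assms by (simp add: Bij_def)
  then show "a \<otimes>\<^bsub>Inj \<Omega>\<^esub> (\<lambda>x\<in>\<Omega>. inv_into \<Omega> a x) = \<one>\<^bsub>Inj \<Omega>\<^esub>"
    and "(\<lambda>x\<in>\<Omega>. inv_into \<Omega> a x) \<otimes>\<^bsub>Inj \<Omega>\<^esub> a = \<one>\<^bsub>Inj \<Omega>\<^esub>"
    by (simp_all add: mult_Inj one_Inj compose_inv_into_id compose_id_inv_into bij_betw_def)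
qed

lemma Units_Inj: "Units (Inj \<Omega>) = Bij \<Omega>"
proof
  show "Bij \<Omega> \<subseteq> Units (Inj \<Omega>)"
    using Bij_inverse_Inj unfolding Units_def by blast
  show "Units (Inj \<Omega>) \<subseteq> Bij \<Omega>"
  proof
    fix a assume "a \<in> Units (Inj \<Omega>)"
    then obtain c where a: "a \<in> carrier (Inj \<Omega>)" and c: "c \<in> carrier (Inj \<Omega>)"
      and ca: "compose \<Omega> a c = (\<lambda>x\<in>\<Omega>. x)"
      by (auto simp: Units_def mult_Inj one_Inj)
    have "x \<in> a ` \<Omega>" if "x \<in> \<Omega>" for x
    proof
      show "x = a (c x)"
        using fun_cong[OF ca, of x] that by (simp add: compose_def)
      show "c x \<in> \<Omega>"
        using c that by (auto simp: carrier_Inj)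
    qed
    with a show "a \<in> Bij \<Omega>"
      by (auto simp: Bij_def carrier_Inj bij_betw_def PiE_iff)
  qed
qed

lemma inv_Inj: "a \<in> Bij \<Omega> \<Longrightarrow> inv\<^bsub>Inj \<Omega>\<^esub> a = (\<lambda>x\<in>\<Omega>. inv_into \<Omega> a x)"
  by (rule monoid.inv_unique'[OF monoid_Inj, symmetric]) (rule Bij_inverse_Inj; assumption)+

end

theory Submission
  imports Defs "HOL-Library.Equipollence"
begin

text \<open>
  Call \<open>\<Omega> - f ` \<Omega>\<close> the defect of an injection \<open>f\<close>. Since maps are injective, the defect of a
  product \<open>f\<^sub>1 f\<^sub>2\<close> is the disjoint union of the defect of \<open>f\<^sub>2\<close> and of a copy of the defect of
  \<open>f\<^sub>1\<close>, and conjugate injections have equipotent defects. So a product of two conjugates of the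
  same map has a defect which, if finite, has an even number of elements.

  Conversely, split the defect of \<open>h\<close> into two equipotent halves \<open>A\<close> and \<open>B\<close>. It suffices to write
  \<open>h x = g (f x)\<close> with \<open>f\<close> and \<open>g\<close> conjugate. Conjugacy is read off from the cycles: the orbits of
  an injection are finite cycles, two-way infinite cycles, and one-way infinite cycles, the last
  ones starting at the points of the defect. Both \<open>f\<close> and \<open>g\<close> are built without finite cycles, with
  \<open>|\<Omega>|\<close> two-way infinite cycles and with \<open>|A| = |B|\<close> one-way infinite cycles; two such maps are
  conjugate (\<open>infinite_cycles_conjugate\<close>).

  The idea behind the construction of \<open>f\<close> and \<open>g\<close> (\<open>factor_into_infinite_cycles\<close>) is to let both
  maps come down along every two-way cycle through one part of \<open>\<Omega>\<close> and then go up through another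
  part for ever, where height is measured by a rank \<open>r :: 'a \<Rightarrow> nat\<close>. Take injections \<open>\<alpha>\<close> and \<open>\<beta>\<close> of
  \<open>\<Omega>\<close> with disjoint images that raise the rank so much that it is still raised if \<open>h\<close> interferes
  (\<open>spreading_maps\<close>). If \<open>f\<close> acts as \<open>\<alpha>\<close> outside a set \<open>V\<close> and as the inverse of \<open>\<beta>\<close> on \<open>V\<close>, then
  \<open>g\<close> is forced on the image of \<open>f\<close>: it sends \<open>\<alpha> x\<close> to \<open>h x\<close>, which is a step down, and every other
  point \<open>y\<close> of this image to \<open>h (\<beta> y)\<close>, which is a step up. That \<open>f\<close> be injective with a prescribed
  defect \<open>A'\<close> asks for sets with \<open>P = \<alpha> ` (\<Omega> - V)\<close> and \<open>V = \<beta> ` (\<Omega> - P - A')\<close>, and these are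
  provided by the Knaster--Tarski fixed point theorem, as in the Schroeder--Bernstein theorem. The
  remaining values of \<open>g\<close> are filled in by a bijection from \<open>A'\<close> to \<open>A\<close>, so that \<open>B\<close> is left as the
  defect of \<open>g\<close>.

  A rank with values in \<open>nat\<close> cannot be injective on an uncountable \<open>\<Omega>\<close>. But \<open>\<Omega>\<close> is a union of
  countably infinite blocks that \<open>h\<close> maps into themselves (\<open>countable_invariant_blocks\<close>), and it is
  enough that \<open>r\<close> be injective on each block and that \<open>\<alpha>\<close> and \<open>\<beta>\<close> preserve the blocks.
\<close>

section \<open>Splitting infinite sets\<close>

lemma infinite_eqpoll_Times_nat:
  assumes "infinite A"
  shows "A \<approx> A \<times> (UNIV :: nat set)"
proof -
  have "(card_of (UNIV :: nat set), card_of A) \<in> ordLeq"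
    using assms by (simp add: infinite_iff_card_of_nat)
  then show ?thesis
    using assms card_of_Times_infinite[of A "UNIV :: nat set"]
    by (simp add: eqpoll_iff_card_of_ordIso ordIso_symmetric)
qed

lemma infinite_halves:
  assumes "infinite D"
  obtains A B where "D = A \<union> B" "A \<inter> B = {}" "A \<approx> B"
proof -
  have "(card_of (UNIV :: bool set), card_of D) \<in> ordLeq"
    using assms by (intro ordLess_imp_ordLeq finite_ordLess_infinite card_of_Well_order)
      (simp_all add: Field_card_of)
  then have "D \<approx> D \<times> (UNIV :: bool set)"
    using assms card_of_Times_infinite[of D "UNIV :: bool set"]
    by (simp add: eqpoll_iff_card_of_ordIso ordIso_symmetric)
  then obtain g where g: "bij_betw g (D \<times> (UNIV :: bool set)) D"
    using eqpoll_def eqpoll_sym by blast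
  let ?half = "\<lambda>b. g ` (D \<times> {b})"
  have "?half b \<approx> D" for b
  proof -
    have "?half b \<approx> D \<times> {b}"
      using g by (intro inj_on_image_eqpoll_self) (auto simp: bij_betw_def inj_on_def)
    also have "\<dots> \<approx> D"
      by (rule eqpoll_trans[OF times_commute_eqpoll times_singleton_eqpoll])
    finally show ?thesis .
  qed
  then have "?half True \<approx> ?half False"
    using eqpoll_sym eqpoll_trans by blast
  moreover have "D = ?half True \<union> ?half False"
  proof -
    have "D \<times> (UNIV :: bool set) = D \<times> {True} \<union> D \<times> {False}" by auto
    then show ?thesis using g by (metis bij_betw_imp_surj_on image_Un)
  qed
  moreover have "?half True \<inter> ?half False = {}"
    using g by (auto simp: bij_betw_def inj_on_def)
  ultimately show thesis using that by blast
qed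

lemma even_card_halves:
  assumes "finite D" "even (card D)"
  obtains A B where "D = A \<union> B" "A \<inter> B = {}" "A \<approx> B"
proof -
  obtain A where A: "A \<subseteq> D" "card A = card D div 2"
    by (metis div_le_dividend obtain_subset_with_card_n)
  then have "card (D - A) = card A"
    using assms by (auto simp: card_Diff_subset finite_subset elim: evenE)
  then have "A \<approx> D - A"
    using A assms by (intro iffD2[OF eqpoll_iff_card]) (auto intro: finite_subset)
  then show thesis using that[of A "D - A"] A by blast
qed

section \<open>Countable blocks invariant under an injection\<close>

lemma funpow_mem:
  assumes "h ` \<Omega> \<subseteq> \<Omega>" "x \<in> \<Omega>"
  shows "(h ^^ n) x \<in> \<Omega>"
  using assms by (induction n) auto

lemma funpow_inj_on:
  assumes "inj_on h \<Omega>" "h ` \<Omega> \<subseteq> \<Omega>"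
  shows "inj_on (h ^^ n) \<Omega>"
proof (induction n)
  case (Suc n)
  have "(h ^^ n) ` \<Omega> \<subseteq> \<Omega>"
    using funpow_mem[OF assms(2)] by blast
  then show ?case
    using comp_inj_on[OF Suc inj_on_subset[OF assms(1)]] by (simp add: comp_def)
qed simp

text \<open>
  The map \<open>\<iota>\<close> names the block of a point, and \<open>r\<close> numbers the points of each block. The orbits of
  \<open>h\<close> are countable and invariant, but they may be finite. If there are infinitely many orbits, the
  set \<open>O\<close> of orbits is equipotent to \<open>O \<times> nat\<close>, so that the orbits can be grouped into blocks of
  countably infinitely many orbits each. If there are finitely many, \<open>\<Omega>\<close> itself is countable and is
  the only block.
\<close>
lemma countable_invariant_blocks:
  fixes h :: "'a \<Rightarrow> 'a"
  assumes "infinite \<Omega>" and inj: "inj_on h \<Omega>" and into: "h ` \<Omega> \<subseteq> \<Omega>"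
  obtains \<iota> :: "'a \<Rightarrow> 'a set" and r :: "'a \<Rightarrow> nat"
  where "\<And>x. x \<in> \<Omega> \<Longrightarrow> \<iota> (h x) = \<iota> x"
    and "\<And>x y. \<lbrakk>x \<in> \<Omega>; y \<in> \<Omega>; \<iota> x = \<iota> y; r x = r y\<rbrakk> \<Longrightarrow> x = y"
    and "\<And>x. x \<in> \<Omega> \<Longrightarrow> infinite {y \<in> \<Omega>. \<iota> y = \<iota> x}"
proof -
  \<comment> \<open>The orbit of \<open>x\<close>: all points whose forward trajectories meet that of \<open>x\<close>.\<close>
  define cl where "cl x = {y \<in> \<Omega>. \<exists>m n. (h ^^ m) x = (h ^^ n) y}" for x
  have self: "x \<in> cl x" if "x \<in> \<Omega>" for x
    using that by (auto simp: cl_def)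
  have cl_eq: "cl x = cl y" if "x \<in> \<Omega>" "y \<in> \<Omega>" "(h ^^ m) x = (h ^^ n) y" for x y m n
  proof -
    have sub: "cl x \<subseteq> cl y" if eq: "(h ^^ m) x = (h ^^ n) y" for x y m n
    proof
      fix z assume "z \<in> cl x"
      then obtain k l where z: "z \<in> \<Omega>" and kl: "(h ^^ k) x = (h ^^ l) z"
        by (auto simp: cl_def)
      have "(h ^^ (k + n)) y = (h ^^ (k + m)) x"
        by (simp add: funpow_add eq)
      also have "\<dots> = (h ^^ (m + k)) x" by (simp add: add.commute)
      also have "\<dots> = (h ^^ (m + l)) z"
        by (simp add: funpow_add kl)
      finally show "z \<in> cl y" using z by (auto simp: cl_def)
    qed
    show ?thesis using sub[OF that(3)] sub[OF that(3)[symmetric]] by blast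
  qed
  have cl_h: "cl (h x) = cl x" if "x \<in> \<Omega>" for x
    using cl_eq[of "h x" x 0 1] that into by auto
  have cl_countable: "countable (cl x)" for x
  proof -
    have "cl x \<subseteq> (\<lambda>(m, n). inv_into \<Omega> (h ^^ n) ((h ^^ m) x)) ` UNIV"
    proof
      fix y assume "y \<in> cl x"
      then obtain m n where y: "y \<in> \<Omega>" and "(h ^^ m) x = (h ^^ n) y"
        by (auto simp: cl_def)
      then have "y = inv_into \<Omega> (h ^^ n) ((h ^^ m) x)"
        using funpow_inj_on[OF inj into] by (simp add: inv_into_f_f)
      then show "y \<in> (\<lambda>(m, n). inv_into \<Omega> (h ^^ n) ((h ^^ m) x)) ` UNIV" by auto
    qed
    then show ?thesis by (rule countable_subset) simp
  qed
  show thesis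
  proof (cases "finite (cl ` \<Omega>)")
    case True
    have "\<Omega> \<subseteq> (\<Union>c\<in>cl ` \<Omega>. c)" using self by blast
    moreover have "countable (\<Union>c\<in>cl ` \<Omega>. c)"
      using True cl_countable by (intro countable_UN) (auto intro: countable_finite)
    ultimately have "countable \<Omega>" using countable_subset by blast
    then show thesis
      using that[of "\<lambda>_. {}" "to_nat_on \<Omega>"] assms(1) by auto
  next
    case False
    then obtain p where p: "bij_betw p (cl ` \<Omega>) (cl ` \<Omega> \<times> (UNIV :: nat set))"
      using infinite_eqpoll_Times_nat unfolding eqpoll_def by blast
    \<comment> \<open>The first component of \<open>p\<close> names the block of an orbit; a point is then numbered by the place
      of its orbit in the block and its own place in the orbit.\<close>
    define \<iota> where "\<iota> x = fst (p (cl x))" for x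
    define r where "r x = prod_encode (snd (p (cl x)), to_nat_on (cl x) x)" for x
    show thesis
    proof (rule that[of \<iota> r])
      show "\<iota> (h x) = \<iota> x" if "x \<in> \<Omega>" for x
        using that by (simp add: \<iota>_def cl_h)
    next
      fix x y assume xy: "x \<in> \<Omega>" "y \<in> \<Omega>" "\<iota> x = \<iota> y" "r x = r y"
      then have "p (cl x) = p (cl y)"
        by (auto simp: \<iota>_def r_def prod_eq_iff)
      then have "cl x = cl y"
        using p xy(1,2) by (auto simp: bij_betw_def inj_on_def)
      moreover from this have "to_nat_on (cl x) x = to_nat_on (cl x) y"
        using xy(4) by (simp add: r_def)
      ultimately show "x = y"
        using self[OF xy(1)] self[OF xy(2)] cl_countable[of x] by simp
    next
      fix x assume x: "x \<in> \<Omega>"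
      have "n \<in> (\<lambda>y. snd (p (cl y))) ` {y \<in> \<Omega>. \<iota> y = \<iota> x}" for n
      proof -
        have "(\<iota> x, n) \<in> cl ` \<Omega> \<times> UNIV"
          using bij_betw_apply[OF p, of "cl x"] x by (simp add: \<iota>_def mem_Times_iff)
        then have "(\<iota> x, n) \<in> p ` cl ` \<Omega>"
          by (simp add: bij_betw_imp_surj_on[OF p])
        then obtain y where "y \<in> \<Omega>" "p (cl y) = (\<iota> x, n)" by force
        then show ?thesis by (intro image_eqI[of _ _ y]) (simp_all add: \<iota>_def)
      qed
      then have "UNIV \<subseteq> (\<lambda>y. snd (p (cl y))) ` {y \<in> \<Omega>. \<iota> y = \<iota> x}" by (rule subsetI)
      then show "infinite {y \<in> \<Omega>. \<iota> y = \<iota> x}"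
        using finite_surj infinite_UNIV_nat by blast
    qed
  qed
qed

section \<open>Maps that raise the rank\<close>

text \<open>
  Each condition excludes only finitely many candidates for the next term, because \<open>r\<close> and \<open>h\<close> are
  injective, so the sequence can be chosen term by term from the infinite set \<open>h ` X\<close>. Together the
  conditions make \<open>s\<close> so sparse that \<open>h\<close> never maps one term to a different one.
\<close>
lemma sparse_sequence:
  fixes r :: "'a \<Rightarrow> nat"
  assumes X: "infinite X" "inj_on r X" and h: "inj_on h X" "h ` X \<subseteq> X"
  obtains s :: "nat \<Rightarrow> 'a"
  where "\<And>n. s n \<in> h ` X"
    and "\<And>n. r (s n) < r (s (Suc n))"
    and "\<And>n. r (s n) < r (h (s (Suc n)))"
    and "\<And>n y. \<lbrakk>y \<in> X; r y \<le> r (s n)\<rbrakk> \<Longrightarrow> r (h y) < r (s (Suc n))"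
proof -
  have fin: "finite {y \<in> X. r y \<le> m}" for m
  proof (rule finite_imageD)
    show "finite (r ` {y \<in> X. r y \<le> m})"
      by (rule finite_subset[of _ "{..m}"]) auto
    show "inj_on r {y \<in> X. r y \<le> m}"
      using X(2) by (rule inj_on_subset) auto
  qed
  define good where "good x y \<longleftrightarrow> r x < r y \<and> r x < r (h y) \<and>
      (\<forall>z \<in> X. r z \<le> r x \<longrightarrow> r (h z) < r y)" for x y
  have "\<exists>s. \<forall>n. s n \<in> h ` X \<and> good (s n) (s (Suc n))"
  proof (rule dependent_nat_choice)
    show "\<exists>x. x \<in> h ` X" using X(1) by (auto intro: infinite_imp_nonempty)
  next
    fix x and n :: nat assume "x \<in> h ` X"
    let ?bad = "{y \<in> X. r y \<le> r x} \<union> {y \<in> X. r (h y) \<le> r x} \<union>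
        (\<Union>z \<in> {z \<in> X. r z \<le> r x}. {y \<in> X. r y \<le> r (h z)})"
    have "finite {y \<in> X. r (h y) \<le> r x}"
    proof (rule finite_imageD)
      show "finite (h ` {y \<in> X. r (h y) \<le> r x})"
        using h(2) by (intro finite_subset[OF _ fin[of "r x"]]) auto
      show "inj_on h {y \<in> X. r (h y) \<le> r x}"
        using h(1) by (rule inj_on_subset) auto
    qed
    then have "finite ?bad" using fin by blast
    moreover have "infinite (h ` X)" using X(1) h(1) finite_imageD by blast
    ultimately obtain y where "y \<in> h ` X" "y \<notin> ?bad"
      by (meson finite_subset subsetI)
    then show "\<exists>y. y \<in> h ` X \<and> good x y"
      using h(2) by (intro exI[of _ y]) (auto simp: good_def not_le)
  qed
  then obtain s where s: "\<And>n. s n \<in> h ` X" "\<And>n. good (s n) (s (Suc n))" by blast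
  show thesis
    by (rule that[of s]) (use s in \<open>auto simp: good_def\<close>)
qed

text \<open>
  Four maps are needed: \<open>\<sigma> 0\<close> and \<open>\<sigma> 1\<close> are the \<open>\<alpha>\<close> and \<open>\<beta>\<close> of the construction, \<open>\<sigma> 2\<close> makes room
  for the defect of the first factor, and \<open>\<sigma> 3\<close> for \<open>|\<Omega>|\<close> two-way cycles. They take their values in a
  sparse sequence of the block of their argument. Their images lie in \<open>h ` \<Omega>\<close>, hence away from
  the defect of \<open>h\<close>, and \<open>h\<close> does not carry one image into another.
\<close>
lemma spreading_maps:
  fixes h :: "'a \<Rightarrow> 'a"
  assumes "infinite \<Omega>" and inj: "inj_on h \<Omega>" and into: "h ` \<Omega> \<subseteq> \<Omega>"
  obtains r :: "'a \<Rightarrow> nat" and \<sigma> :: "nat \<Rightarrow> 'a \<Rightarrow> 'a"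
  where "\<And>j x. x \<in> \<Omega> \<Longrightarrow> \<sigma> j x \<in> h ` \<Omega>"
    and "\<And>j k x y. \<lbrakk>j < 4; k < 4; x \<in> \<Omega>; y \<in> \<Omega>; \<sigma> j x = \<sigma> k y\<rbrakk> \<Longrightarrow> j = k \<and> x = y"
    and "\<And>j k x y. \<lbrakk>j < 4; k < 4; x \<in> \<Omega>; y \<in> \<Omega>; h (\<sigma> j x) = \<sigma> k y\<rbrakk> \<Longrightarrow> j = k"
    and "\<And>j x. x \<in> \<Omega> \<Longrightarrow> r x < r (\<sigma> j x)"
    and "\<And>j x. x \<in> \<Omega> \<Longrightarrow> r (h x) < r (\<sigma> j x)"
    and "\<And>j x. x \<in> \<Omega> \<Longrightarrow> r x < r (h (\<sigma> j x))"
proof -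
  obtain \<iota> :: "'a \<Rightarrow> 'a set" and r :: "'a \<Rightarrow> nat"
    where \<iota>h: "\<And>x. x \<in> \<Omega> \<Longrightarrow> \<iota> (h x) = \<iota> x"
      and \<iota>r: "\<And>x y. \<lbrakk>x \<in> \<Omega>; y \<in> \<Omega>; \<iota> x = \<iota> y; r x = r y\<rbrakk> \<Longrightarrow> x = y"
      and inf: "\<And>x. x \<in> \<Omega> \<Longrightarrow> infinite {y \<in> \<Omega>. \<iota> y = \<iota> x}"
    by (rule countable_invariant_blocks[OF assms]) blast
  let ?X = "\<lambda>i. {y \<in> \<Omega>. \<iota> y = i}"
  have "\<exists>s. \<forall>n. s n \<in> h ` ?X i \<and> r (s n) < r (s (Suc n)) \<and> r (s n) < r (h (s (Suc n))) \<and>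
      (\<forall>y \<in> ?X i. r y \<le> r (s n) \<longrightarrow> r (h y) < r (s (Suc n)))" if "i \<in> \<iota> ` \<Omega>" for i
  proof -
    have "infinite (?X i)" using that inf by auto
    moreover have "inj_on r (?X i)" using \<iota>r by (auto simp: inj_on_def)
    moreover have "inj_on h (?X i)" using inj by (rule inj_on_subset) auto
    moreover have "h ` ?X i \<subseteq> ?X i" using into \<iota>h by auto
    ultimately obtain t where "\<And>n. t n \<in> h ` ?X i" "\<And>n. r (t n) < r (t (Suc n))"
        "\<And>n. r (t n) < r (h (t (Suc n)))"
        "\<And>n y. \<lbrakk>y \<in> ?X i; r y \<le> r (t n)\<rbrakk> \<Longrightarrow> r (h y) < r (t (Suc n))"
      by (rule sparse_sequence) (rule that; assumption)
    then show ?thesis by (intro exI[of _ t]) simp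
  qed
  then obtain s where "\<forall>i \<in> \<iota> ` \<Omega>. \<forall>n. s i n \<in> h ` ?X i \<and> r (s i n) < r (s i (Suc n)) \<and>
      r (s i n) < r (h (s i (Suc n))) \<and> (\<forall>y \<in> ?X i. r y \<le> r (s i n) \<longrightarrow> r (h y) < r (s i (Suc n)))"
    by (rule bchoice[OF ballI, THEN exE])
  then have s: "\<And>i n. i \<in> \<iota> ` \<Omega> \<Longrightarrow> s i n \<in> h ` ?X i"
      and s_mono: "\<And>i n. i \<in> \<iota> ` \<Omega> \<Longrightarrow> r (s i n) < r (s i (Suc n))"
      and s_h: "\<And>i n. i \<in> \<iota> ` \<Omega> \<Longrightarrow> r (s i n) < r (h (s i (Suc n)))"
      and h_s: "\<And>i n y. \<lbrakk>i \<in> \<iota> ` \<Omega>; y \<in> ?X i; r y \<le> r (s i n)\<rbrakk> \<Longrightarrow> r (h y) < r (s i (Suc n))"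
    by blast+
  have s_mem: "s i n \<in> \<Omega>" "\<iota> (s i n) = i" if "i \<in> \<iota> ` \<Omega>" for i n
    using s[OF that, of n] into \<iota>h by auto
  have s_less: "r (s i m) < r (s i n) \<longleftrightarrow> m < n" if "i \<in> \<iota> ` \<Omega>" for i m n
    using strict_mono_less[of "\<lambda>n. r (s i n)" m n] s_mono[OF that] by (simp add: strict_mono_Suc_iff)
  have s_ge: "n \<le> r (s i n)" if "i \<in> \<iota> ` \<Omega>" for i n
    using strict_mono_imp_increasing[of "\<lambda>n. r (s i n)" n] s_mono[OF that]
    by (simp add: strict_mono_Suc_iff)
  have s_neq: "m = n" if i: "i \<in> \<iota> ` \<Omega>" and eq: "h (s i m) = s i n" for i m n
  proof (rule ccontr)
    assume "m \<noteq> n"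
    then consider k where "m = Suc k" "n \<le> k" | k where "n = Suc k" "m \<le> k"
      by (metis less_Suc_eq_le lessE linorder_neqE_nat)
    then show False
    proof cases
      case 1
      then have "r (s i n) \<le> r (s i k)" using s_less[OF i, of k n] by linarith
      with 1 s_h[OF i, of k] eq show False by simp
    next
      case 2
      then have "r (s i m) \<le> r (s i k)" using s_less[OF i, of k m] by linarith
      with 2 h_s[OF i, of "s i m" k] s_mem[OF i, of m] eq show False by simp
    qed
  qed
  \<comment> \<open>The index is larger than \<open>r x\<close>, which makes the rank grow, and its residue modulo 4 separates
    the four images.\<close>
  define \<sigma> where "\<sigma> j x = s (\<iota> x) (Suc (4 * r x + j))" for j x
  show thesis
  proof (rule that[of \<sigma> r])
    fix j x assume x: "x \<in> \<Omega>"
    then have i: "\<iota> x \<in> \<iota> ` \<Omega>" by simp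
    show "\<sigma> j x \<in> h ` \<Omega>" using s[OF i] by (auto simp: \<sigma>_def)
    show "r x < r (\<sigma> j x)"
      using s_ge[OF i, of "Suc (4 * r x + j)"] by (simp add: \<sigma>_def)
    show "r x < r (h (\<sigma> j x))"
      using s_ge[OF i, of "4 * r x + j"] s_h[OF i, of "4 * r x + j"] by (simp add: \<sigma>_def)
    have "r (h x) < r (s (\<iota> x) (Suc (r x)))"
      using h_s[OF i, of x "r x"] s_ge[OF i, of "r x"] x by simp
    also have "\<dots> \<le> r (\<sigma> j x)"
      using s_less[OF i, of "Suc (4 * r x + j)" "Suc (r x)"] by (simp add: \<sigma>_def)
    finally show "r (h x) < r (\<sigma> j x)" .
  next
    fix j k :: nat and x y
    assume jk: "j < 4" "k < 4" and x: "x \<in> \<Omega>" and y: "y \<in> \<Omega>"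
    then have i: "\<iota> x \<in> \<iota> ` \<Omega>" "\<iota> y \<in> \<iota> ` \<Omega>" by auto
    {
      assume eq: "\<sigma> j x = \<sigma> k y"
      then have \<iota>: "\<iota> x = \<iota> y"
        using s_mem(2)[OF i(1)] s_mem(2)[OF i(2)] by (metis \<sigma>_def)
      with eq have "4 * r x + j = 4 * r y + k"
        using s_less[OF i(1)] unfolding \<sigma>_def
        by (metis Suc_inject linorder_neqE_nat less_irrefl)
      with jk have "j = k" "r x = r y" by presburger+
      with \<iota> show "j = k \<and> x = y" using \<iota>r x y by blast
    }
    {
      assume eq: "h (\<sigma> j x) = \<sigma> k y"
      then have "\<iota> x = \<iota> y"
        using s_mem[OF i(1)] s_mem(2)[OF i(2)] \<iota>h by (metis \<sigma>_def)
      with eq have "Suc (4 * r x + j) = Suc (4 * r y + k)"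
        using s_neq[OF i(1), of "Suc (4 * r x + j)" "Suc (4 * r y + k)"] by (simp add: \<sigma>_def)
      with jk show "j = k" by presburger
    }
  qed
qed

section \<open>Injections without finite cycles\<close>

text \<open>
  All cycles of \<open>f\<close> on \<open>\<Omega>\<close> are infinite, \<open>K\<close> contains one point of each two-way cycle, and \<open>N\<close> is
  the set of starting points of the one-way cycles. The point \<open>\<psi> (d, n)\<close> lies \<open>n\<close> steps after \<open>d\<close>
  on the cycle of \<open>d\<close>.
\<close>
definition infinite_cycles :: "'a set \<Rightarrow> ('a \<Rightarrow> 'a) \<Rightarrow> 'a set \<Rightarrow> 'a set \<Rightarrow> bool" where
  "infinite_cycles \<Omega> f K N \<longleftrightarrow> K \<inter> N = {} \<and>
     (\<exists>\<psi> :: 'a \<times> int \<Rightarrow> 'a. bij_betw \<psi> (K \<times> UNIV \<union> N \<times> {0..}) \<Omega> \<and>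
        (\<forall>(d, n) \<in> K \<times> UNIV \<union> N \<times> {0..}. f (\<psi> (d, n)) = \<psi> (d, n + 1)))"

text \<open>
  A two-way cycle runs through \<open>H\<close>, where \<open>\<tau>\<close> decreases, leaves it at a point of \<open>K\<close> and goes on
  through \<open>G\<close>, where \<open>\<rho>\<close> increases; a one-way cycle starts in \<open>N\<close> and stays in \<open>G\<close>. The ranks make
  this exhaustive: going forward from \<open>H\<close>, or backward from \<open>G\<close>, must come to an end. Points of \<open>K\<close>
  belong to different cycles, and these are not finite, because \<open>G\<close> is never left.
\<close>
lemma infinite_cyclesI:
  fixes \<rho> \<tau> :: "'a \<Rightarrow> nat"
  assumes inj: "inj_on f \<Omega>"
    and \<Omega>: "\<Omega> = K \<union> N \<union> G \<union> H" and disj: "K \<inter> N = {}" "(K \<union> N) \<inter> G = {}" "N \<inter> H = {}"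
    and G: "f ` (K \<union> N \<union> G) = G" and H: "f ` H = K \<union> H"
    and \<rho>: "\<And>x. x \<in> K \<union> N \<union> G \<Longrightarrow> \<rho> x < \<rho> (f x)"
    and \<tau>: "\<And>x. x \<in> H \<Longrightarrow> \<tau> (f x) < \<tau> x"
  shows "infinite_cycles \<Omega> f K N"
proof -
  let ?D = "K \<times> UNIV \<union> N \<times> {0..} :: ('a \<times> int) set"
  define g where "g = inv_into H f"
  define \<psi> :: "'a \<times> int \<Rightarrow> 'a" where
    "\<psi> = (\<lambda>(d, n). if 0 \<le> n then (f ^^ nat n) d else (g ^^ nat (- n)) d)"
  have into: "f ` \<Omega> \<subseteq> \<Omega>"
    using G H unfolding \<Omega> by (auto simp: image_Un)
  have g: "g x \<in> H" "f (g x) = x" if "x \<in> K \<union> H" for x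
    using that inv_into_into[of x f H] f_inv_into_f[of x f H] by (simp_all add: g_def H)
  have bwd: "(g ^^ m) d \<in> K \<union> H" if "d \<in> K" for m d
    using that g(1) by (induction m) auto
  have fwd: "(f ^^ m) d \<in> K \<union> N \<union> G" if "d \<in> K \<union> N" for m d
    using that G by (induction m) auto
  have fwd_G: "\<psi> (d, n) \<in> G" if "d \<in> K \<union> N" "0 < n" for d n
  proof -
    obtain m where "nat n = Suc m" using \<open>0 < n\<close> gr0_implies_Suc by fastforce
    then have "\<psi> (d, n) = f ((f ^^ m) d)" using \<open>0 < n\<close> by (simp add: \<psi>_def)
    then show ?thesis using fwd[OF that(1), of m] G by auto
  qed
  have \<psi>0: "\<psi> (d, 0) = d" for d by (simp add: \<psi>_def)
  have \<psi>_mem: "\<psi> p \<in> \<Omega>" if "p \<in> ?D" for p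
    using that fwd bwd unfolding \<Omega> \<psi>_def by fastforce
  have step: "f (\<psi> (d, n)) = \<psi> (d, n + 1)" if "(d, n) \<in> ?D" for d n
  proof (cases "0 \<le> n")
    case True
    then show ?thesis by (simp add: \<psi>_def nat_add_distrib)
  next
    case False
    then have d: "d \<in> K" using that by auto
    obtain m where m: "nat (- n) = Suc m"
      using False by (metis gr0_implies_Suc neg_0_less_iff_less not_le zero_less_nat_eq)
    then have n: "n = - int m - 1" using False by linarith
    then have "\<psi> (d, n + 1) = (g ^^ m) d" by (simp add: \<psi>_def)
    moreover have "\<psi> (d, n) = g ((g ^^ m) d)" using False m by (simp add: \<psi>_def)
    ultimately show ?thesis using g(2) bwd[OF d] by simp
  qed
  have steps: "(f ^^ m) (\<psi> (d, n)) = \<psi> (d, n + int m)" if "(d, n) \<in> ?D" for m d n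
  proof (induction m)
    case (Suc m)
    moreover have "(d, n + int m) \<in> ?D" using that by auto
    ultimately show ?case by (simp add: step algebra_simps)
  qed simp
  have inj_le: "d = d' \<and> n = n'"
    if D: "(d, n) \<in> ?D" "(d', n') \<in> ?D" and eq: "\<psi> (d, n) = \<psi> (d', n')" and le: "n \<le> n'"
    for d d' n n'
  proof -
    have D': "(d, 0) \<in> ?D" "(d', n' - n) \<in> ?D" using D le by auto
    \<comment> \<open>Both points are moved along their cycles until the first one arrives at its base point \<open>d\<close>:
      backward by injectivity of \<open>f\<close> if \<open>n\<close> is nonnegative, else forward.\<close>
    have "d = \<psi> (d', n' - n)"
    proof (cases "0 \<le> n")
      case True
      have "(f ^^ nat n) (\<psi> (d, 0)) = (f ^^ nat n) (\<psi> (d', n' - n))"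
        using eq True steps[OF D'(1), of "nat n"] steps[OF D'(2), of "nat n"] by simp
      then show ?thesis
        using funpow_inj_on[OF inj into] \<psi>_mem[OF D'(1)] \<psi>_mem[OF D'(2)] \<psi>0
        by (metis inj_onD)
    next
      case False
      then show ?thesis
        using steps[OF D(1), of "nat (- n)"] steps[OF D(2), of "nat (- n)"] eq \<psi>0 by simp
    qed
    moreover have "d \<in> K \<union> N" "d' \<in> K \<union> N" using D by auto
    ultimately have "n' - n = 0" using fwd_G[of d' "n' - n"] disj(2) le by fastforce
    then show ?thesis using \<open>d = \<psi> (d', n' - n)\<close> \<psi>0 by simp
  qed
  have "inj_on \<psi> ?D"
  proof (rule inj_onI)
    fix p q assume "p \<in> ?D" "q \<in> ?D" "\<psi> p = \<psi> q"
    then show "p = q"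
      using inj_le[of "fst p" "snd p" "fst q" "snd q"] inj_le[of "fst q" "snd q" "fst p" "snd p"]
      by (cases "snd p \<le> snd q") (auto simp: prod_eq_iff)
  qed
  moreover have "\<psi> ` ?D = \<Omega>"
  proof
    show "\<psi> ` ?D \<subseteq> \<Omega>" using \<psi>_mem by blast
    have base: "x \<in> \<psi> ` ?D" if "x \<in> K \<union> N" for x
      using that \<psi>0[of x] by (intro image_eqI[of _ _ "(x, 0)"]) auto
    have up: "x \<in> \<psi> ` ?D" if "x \<in> G" for x
      using that
    proof (induction x rule: measure_induct_rule[of \<rho>])
      case (less x)
      then obtain y where y: "y \<in> K \<union> N \<union> G" "x = f y" using G by blast
      then have "y \<in> \<psi> ` ?D" using less.IH[of y] \<rho>[of y] base by blast
      then obtain d n where "(d, n) \<in> ?D" "y = \<psi> (d, n)" by force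
      then have "x = \<psi> (d, n + 1)" "(d, n + 1) \<in> ?D" using step y by auto
      then show ?case by blast
    qed
    have down: "x \<in> \<psi> ` ?D" if "x \<in> H" for x
      using that
    proof (induction x rule: measure_induct_rule[of \<tau>])
      case (less x)
      then have fx: "f x \<in> K \<union> H" using H by blast
      then have "f x \<in> \<psi> ` ?D" using less.IH[of "f x"] \<tau>[of x] less.prems base by blast
      then obtain d n where D: "(d, n) \<in> ?D" and eq: "f x = \<psi> (d, n)" by force
      have "(d, n - 1) \<in> ?D"
      proof (rule ccontr)
        assume "(d, n - 1) \<notin> ?D"
        then have "d \<in> N" "n = 0" using D by auto
        then show False using eq \<psi>0[of d] fx disj by auto
      qed
      moreover from this have "x = \<psi> (d, n - 1)"
        using step[of d "n - 1"] eq \<psi>_mem[of "(d, n - 1)"] inj less.prems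
        by (auto simp: inj_on_def \<Omega>)
      ultimately show ?case by blast
    qed
    show "\<Omega> \<subseteq> \<psi> ` ?D" using base up down unfolding \<Omega> by blast
  qed
  ultimately show ?thesis
    unfolding infinite_cycles_def bij_betw_def using disj(1) step by (intro conjI exI[of _ \<psi>]) auto
qed

text \<open>A matching of base points extends along the cycles.\<close>
lemma infinite_cycles_conjugate:
  assumes f: "infinite_cycles \<Omega> f K N" and f': "infinite_cycles \<Omega> f' K' N'"
    and K: "K \<approx> K'" and N: "N \<approx> N'"
  obtains b where "bij_betw b \<Omega> \<Omega>" "\<And>x. x \<in> \<Omega> \<Longrightarrow> b (f x) = f' (b x)"
proof -
  let ?D = "\<lambda>K N. K \<times> UNIV \<union> N \<times> {0..} :: ('a \<times> int) set"
  obtain \<psi> where \<psi>: "bij_betw \<psi> (?D K N) \<Omega>"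
      "\<And>d n. (d, n) \<in> ?D K N \<Longrightarrow> f (\<psi> (d, n)) = \<psi> (d, n + 1)" and KN: "K \<inter> N = {}"
    using f unfolding infinite_cycles_def by fast
  obtain \<psi>' where \<psi>': "bij_betw \<psi>' (?D K' N') \<Omega>"
      "\<And>d n. (d, n) \<in> ?D K' N' \<Longrightarrow> f' (\<psi>' (d, n)) = \<psi>' (d, n + 1)" and KN': "K' \<inter> N' = {}"
    using f' unfolding infinite_cycles_def by fast
  obtain p q where p: "bij_betw p K K'" and q: "bij_betw q N N'"
    using K N unfolding eqpoll_def by blast
  define \<theta> where "\<theta> d = (if d \<in> K then p d else q d)" for d
  have "bij_betw \<theta> K K'"
    using p by (rule bij_betw_cong[THEN iffD1, rotated]) (simp add: \<theta>_def)
  moreover have "bij_betw \<theta> N N'"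
    using q by (rule bij_betw_cong[THEN iffD1, rotated]) (use KN in \<open>auto simp: \<theta>_def\<close>)
  ultimately have \<theta>K: "bij_betw (map_prod \<theta> id) (K \<times> (UNIV :: int set)) (K' \<times> (UNIV :: int set))"
    and \<theta>N: "bij_betw (map_prod \<theta> id) (N \<times> {0 :: int..}) (N' \<times> {0 :: int..})"
    by (auto intro!: bij_betw_map_prod)
  have \<theta>: "bij_betw (map_prod \<theta> id) (?D K N) (?D K' N')"
    using bij_betw_combine[OF \<theta>K \<theta>N] KN' by blast
  define \<phi> where "\<phi> = inv_into (?D K N) \<psi>"
  have \<phi>: "bij_betw \<phi> \<Omega> (?D K N)" unfolding \<phi>_def by (rule bij_betw_inv_into[OF \<psi>(1)])
  define b where "b = \<psi>' \<circ> map_prod \<theta> id \<circ> \<phi>"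
  show thesis
  proof
    show "bij_betw b \<Omega> \<Omega>"
      unfolding b_def using \<phi> \<theta> \<psi>'(1) by (auto intro: bij_betw_trans)
    fix x assume x: "x \<in> \<Omega>"
    obtain d n where dn: "\<phi> x = (d, n)" by fastforce
    then have D: "(d, n) \<in> ?D K N" using \<phi> x by (metis bij_betw_apply)
    then have D1: "(d, n + 1) \<in> ?D K N" by auto
    have "x = \<psi> (d, n)"
      using bij_betw_inv_into_right[OF \<psi>(1) x] dn by (simp add: \<phi>_def)
    then have "\<phi> (f x) = (d, n + 1)"
      using \<psi>(2)[OF D] bij_betw_inv_into_left[OF \<psi>(1) D1] by (simp add: \<phi>_def)
    moreover have "(\<theta> d, n) \<in> ?D K' N'"
      using \<theta> D bij_betw_apply[OF \<theta> D] by simp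
    ultimately show "b (f x) = f' (b x)"
      using \<psi>'(2) dn by (simp add: b_def)
  qed
qed

section \<open>Factoring an injection\<close>

lemma inj_on_Un_disjoint_images:
  assumes "inj_on f X" "inj_on f Y" "f ` X \<inter> f ` Y = {}"
  shows "inj_on f (X \<union> Y)"
  using assms by (auto simp: inj_on_Un)

text \<open>
  Here \<open>A'\<close> and \<open>B\<close> are the defects of \<open>f\<close> and \<open>g\<close>. The map \<open>f\<close> goes down on \<open>V\<close> and up on the rest,
  whereas \<open>g\<close> goes down on \<open>P\<close> and up on the rest, except that it carries \<open>A'\<close> to \<open>A\<close>. The cycles
  turn from down to up at the points of \<open>K\<close> for \<open>f\<close> and of \<open>L\<close> for \<open>g\<close>. Both sets contain the
  image \<open>M\<close> of \<open>\<sigma> 3\<close>, which is the reason for having a spare copy of \<open>\<Omega>\<close>: it forces the number of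
  two-way cycles to be \<open>|\<Omega>|\<close> for both maps.
\<close>
lemma factor_into_infinite_cycles:
  fixes h :: "'a \<Rightarrow> 'a"
  assumes "infinite \<Omega>" and inj: "inj_on h \<Omega>" and into: "h ` \<Omega> \<subseteq> \<Omega>"
    and AB: "\<Omega> - h ` \<Omega> = A \<union> B" "A \<inter> B = {}"
  obtains f g K L A'
  where "inj_on f \<Omega>" "f ` \<Omega> \<subseteq> \<Omega>" and "\<And>x. x \<in> \<Omega> \<Longrightarrow> h x = g (f x)"
    and "infinite_cycles \<Omega> f K A'" "A' \<approx> A" "K \<approx> \<Omega>"
    and "infinite_cycles \<Omega> g L B" "L \<approx> \<Omega>"
proof -
  obtain r :: "'a \<Rightarrow> nat" and \<sigma> :: "nat \<Rightarrow> 'a \<Rightarrow> 'a"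
    where \<sigma>_h: "\<And>j x. x \<in> \<Omega> \<Longrightarrow> \<sigma> j x \<in> h ` \<Omega>"
      and \<sigma>_inj: "\<And>j k x y. \<lbrakk>j < 4; k < 4; x \<in> \<Omega>; y \<in> \<Omega>; \<sigma> j x = \<sigma> k y\<rbrakk> \<Longrightarrow> j = k \<and> x = y"
      and h\<sigma>: "\<And>j k x y. \<lbrakk>j < 4; k < 4; x \<in> \<Omega>; y \<in> \<Omega>; h (\<sigma> j x) = \<sigma> k y\<rbrakk> \<Longrightarrow> j = k"
      and r: "\<And>j x. x \<in> \<Omega> \<Longrightarrow> r x < r (\<sigma> j x)" "\<And>j x. x \<in> \<Omega> \<Longrightarrow> r (h x) < r (\<sigma> j x)"
        "\<And>j x. x \<in> \<Omega> \<Longrightarrow> r x < r (h (\<sigma> j x))"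
    by (rule spreading_maps[OF assms(1-3)]) blast
  define \<alpha> \<beta> where "\<alpha> = \<sigma> 0" and "\<beta> = \<sigma> 1"
  define A' where "A' = \<sigma> 2 ` A"
  define M where "M = \<sigma> 3 ` \<Omega>"
  have A\<Omega>: "A \<subseteq> \<Omega>" "A \<inter> h ` \<Omega> = {}" and B\<Omega>: "B \<subseteq> \<Omega>" "B \<inter> h ` \<Omega> = {}" using AB by auto
  have \<sigma>_mem: "\<sigma> j x \<in> \<Omega>" if "x \<in> \<Omega>" for j x
    using \<sigma>_h[OF that] into by blast
  have inj_\<sigma>: "inj_on (\<sigma> j) \<Omega>" if "j < 4" for j
    using \<sigma>_inj[of j j] that by (auto simp: inj_on_def)
  have disj: "\<sigma> j ` X \<inter> \<sigma> k ` Y = {}" if "j < 4" "k < 4" "j \<noteq> k" "X \<subseteq> \<Omega>" "Y \<subseteq> \<Omega>" for j k X Y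
    using \<sigma>_inj[of j k] that by blast
  have h_disj: "h ` \<sigma> j ` X \<inter> \<sigma> k ` Y = {}" if "j < 4" "k < 4" "j \<noteq> k" "X \<subseteq> \<Omega>" "Y \<subseteq> \<Omega>" for j k X Y
    using h\<sigma>[of j k] that by blast
  have A'\<Omega>: "A' \<subseteq> h ` \<Omega>" using \<sigma>_h A\<Omega> by (auto simp: A'_def)
  \<comment> \<open>The equations wanted for \<open>P\<close> and \<open>V\<close> refer to each other; with \<open>V\<close> substituted, the right-hand
    side for \<open>P\<close> contains \<open>P\<close> under two complements and is monotone.\<close>
  define F where "F P = \<alpha> ` (\<Omega> - \<beta> ` (\<Omega> - P - A'))" for P
  have "mono F" unfolding F_def by (rule monoI) blast
  define P where "P = lfp F"
  define V where "V = \<beta> ` (\<Omega> - P - A')"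
  have P: "P = \<alpha> ` (\<Omega> - V)"
    using lfp_unfold[OF \<open>mono F\<close>] unfolding P_def[symmetric] by (simp add: F_def V_def)
  have V\<Omega>: "V \<subseteq> h ` \<Omega>" and P\<Omega>: "P \<subseteq> h ` \<Omega>" and M\<Omega>: "M \<subseteq> h ` \<Omega>"
    using \<sigma>_h unfolding V_def M_def by (auto simp: P \<alpha>_def \<beta>_def)
  have sub: "V \<subseteq> \<Omega>" "P \<subseteq> \<Omega>" "A' \<subseteq> \<Omega>" "M \<subseteq> \<Omega>"
    using V\<Omega> P\<Omega> A'\<Omega> M\<Omega> into by blast+
  have hV: "h ` V \<subseteq> \<Omega>" "A \<inter> h ` V = {}" "B \<inter> h ` V = {}"
    using sub(1) into A\<Omega> B\<Omega> by blast+
  obtain P0 V0 where P0: "P = \<sigma> 0 ` P0" "P0 \<subseteq> \<Omega>" and V0: "V = \<sigma> 1 ` V0" "V0 \<subseteq> \<Omega>"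
    using P unfolding V_def \<alpha>_def \<beta>_def by blast
  have PV: "P \<inter> V = {}" and PA: "P \<inter> A' = {}" and VA: "V \<inter> A' = {}"
    and MP: "M \<inter> P = {}" and MV: "M \<inter> V = {}" and MA: "M \<inter> A' = {}"
    using P0(2) V0(2) A\<Omega>(1) by (simp_all add: P0(1) V0(1) A'_def M_def disj)
  have hVP: "h ` V \<inter> P = {}" and hVA: "h ` V \<inter> A' = {}" and hVM: "h ` V \<inter> M = {}"
    using P0(2) V0(2) A\<Omega>(1) by (simp_all add: P0(1) V0(1) A'_def M_def h_disj)

  have inj_\<alpha>: "inj_on \<alpha> \<Omega>" and inj_\<beta>: "inj_on \<beta> \<Omega>" and inj_2: "inj_on (\<sigma> 2) \<Omega>"
    using inj_\<sigma> by (simp_all add: \<alpha>_def \<beta>_def)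
  define f where "f x = (if x \<in> V then inv_into \<Omega> \<beta> x else \<alpha> x)" for x
  define g where "g y = (if y \<in> P then h (inv_into \<Omega> \<alpha> y)
      else if y \<in> A' then inv_into \<Omega> (\<sigma> 2) y else h (\<beta> y))" for y
  have f_V: "f (\<beta> y) = y" if "y \<in> \<Omega> - P - A'" for y
    using that inj_\<beta> by (simp add: f_def V_def)
  have f_U: "f x = \<alpha> x" if "x \<in> \<Omega> - V" for x
    using that by (simp add: f_def)
  have g_P: "g (\<alpha> x) = h x" if "x \<in> \<Omega> - V" for x
    using that inj_\<alpha> P by (simp add: g_def)
  have g_A: "g (\<sigma> 2 a) = a" if "a \<in> A" for a
  proof -
    have "\<sigma> 2 a \<in> A'" using that by (simp add: A'_def)
    then show ?thesis using that PA inj_2 A\<Omega> by (auto simp: g_def)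
  qed
  have g_Q: "g y = h (\<beta> y)" if "y \<in> \<Omega> - P - A'" for y
    using that by (simp add: g_def)

  define K where "K = \<Omega> - V - P - A'"
  define L where "L = \<Omega> - P - h ` V - (A \<union> B)"
  have f_img_V: "f ` V = \<Omega> - P - A'" using f_V by (force simp: V_def)
  have f_img_U: "f ` (\<Omega> - V) = P" using f_U P by simp
  have g_img_P: "g ` P = h ` (\<Omega> - V)"
    using g_P by (subst P) (simp add: image_image)
  have g_img_A: "g ` A' = A" using g_A by (simp add: A'_def image_image)
  have g_img_Q: "g ` (\<Omega> - P - A') = h ` V" using g_Q by (simp add: V_def image_image)
  have h_diff: "h ` (\<Omega> - V) = h ` \<Omega> - h ` V" using inj sub by (simp add: inj_on_image_set_diff)

  have inj_f: "inj_on f \<Omega>"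
  proof -
    have "inj_on f V"
      unfolding V_def by (rule inj_onI) (use f_V in auto)
    moreover have "inj_on f (\<Omega> - V)"
      using inj_\<alpha> by (rule inj_on_subset[THEN inj_on_cong[THEN iffD1, rotated]]) (use f_U in auto)
    ultimately have "inj_on f (V \<union> (\<Omega> - V))"
      by (rule inj_on_Un_disjoint_images) (auto simp: f_img_V f_img_U)
    then show ?thesis using sub by (simp add: Un_absorb1)
  qed
  have inj_g: "inj_on g \<Omega>"
  proof -
    have "inj_on g P"
      unfolding P by (rule inj_onI) (use g_P inj in \<open>auto dest: inj_onD\<close>)
    moreover have "inj_on g A'"
      unfolding A'_def by (rule inj_onI) (use g_A in auto)
    moreover have "inj_on g (\<Omega> - P - A')"
    proof (rule inj_onI)
      fix x y assume xy: "x \<in> \<Omega> - P - A'" "y \<in> \<Omega> - P - A'" "g x = g y"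
      then have "\<beta> x = \<beta> y"
        using g_Q inj_onD[OF inj, of "\<beta> x" "\<beta> y"] \<sigma>_mem by (simp add: \<beta>_def)
      then show "x = y" using xy inj_onD[OF inj_\<beta>] by simp
    qed
    moreover have "g ` A' \<inter> g ` (\<Omega> - P - A') = {}"
      unfolding g_img_A g_img_Q by (rule hV(2))
    moreover have "g ` P \<inter> g ` (A' \<union> (\<Omega> - P - A')) = {}"
      unfolding image_Un g_img_P g_img_A g_img_Q h_diff using A\<Omega> by blast
    ultimately have "inj_on g (P \<union> (A' \<union> (\<Omega> - P - A')))"
      by (intro inj_on_Un_disjoint_images)
    moreover have "P \<union> (A' \<union> (\<Omega> - P - A')) = \<Omega>" using sub by blast
    ultimately show ?thesis by simp
  qed

  have f_cycles: "infinite_cycles \<Omega> f K A'"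
  proof (rule infinite_cyclesI[OF inj_f, where G = P and H = V and \<rho> = r and \<tau> = r])
    show "\<Omega> = K \<union> A' \<union> P \<union> V" using sub by (auto simp: K_def)
    show "K \<inter> A' = {}" "(K \<union> A') \<inter> P = {}" "A' \<inter> V = {}"
      using PA VA by (auto simp: K_def)
    have U: "K \<union> A' \<union> P = \<Omega> - V" using sub PV VA by (auto simp: K_def)
    then show "f ` (K \<union> A' \<union> P) = P" using f_img_U by simp
    show "f ` V = K \<union> V" using f_img_V sub PV VA by (auto simp: K_def)
    show "r x < r (f x)" if "x \<in> K \<union> A' \<union> P" for x
      using that f_U[of x] r(1)[of x 0] unfolding U by (simp add: \<alpha>_def)
    show "r (f x) < r x" if x: "x \<in> V" for x
    proof -
      obtain y where "y \<in> \<Omega> - P - A'" "x = \<beta> y" using x by (auto simp: V_def)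
      then show ?thesis using f_V[of y] r(1)[of y 1] by (simp add: \<beta>_def)
    qed
  qed
  have g_cycles: "infinite_cycles \<Omega> g L B"
  proof -
    \<comment> \<open>The step of \<open>g\<close> from \<open>A'\<close> to \<open>A\<close> may lower \<open>r\<close>. All other steps from points outside \<open>P\<close>
      lead into \<open>h ` V\<close>, away from \<open>A'\<close> and \<open>A\<close>, so these sets can be given the two least ranks.\<close>
    define \<rho> where "\<rho> x = (if x \<in> A' then 0 else if x \<in> A then 1 else r x + 2)" for x
    have Q: "L \<union> B \<union> (h ` V \<union> A) = \<Omega> - P"
      using sub hV AB A\<Omega> B\<Omega> P\<Omega> hVP by (auto simp: L_def)
    have A_A': "A \<inter> A' = {}" using A\<Omega> A'\<Omega> by blast
    show ?thesis
    proof (rule infinite_cyclesI[OF inj_g, where G = "h ` V \<union> A" and H = P and \<rho> = \<rho> and \<tau> = r])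
      show "\<Omega> = L \<union> B \<union> (h ` V \<union> A) \<union> P" using Q sub by blast
      show "L \<inter> B = {}" "(L \<union> B) \<inter> (h ` V \<union> A) = {}" "B \<inter> P = {}"
        using AB(2) B\<Omega> P\<Omega> hV by (auto simp: L_def)
      have "\<Omega> - P = A' \<union> (\<Omega> - P - A')" using sub PA by blast
      then show "g ` (L \<union> B \<union> (h ` V \<union> A)) = h ` V \<union> A"
        unfolding Q using g_img_A g_img_Q by (metis image_Un Un_commute)
      show "g ` P = L \<union> P"
        unfolding g_img_P h_diff L_def using AB P\<Omega> hVP into by blast
      show "r (g x) < r x" if x: "x \<in> P" for x
      proof -
        obtain u where "u \<in> \<Omega> - V" "x = \<alpha> u" using x P by auto
        then show ?thesis using g_P[of u] r(2)[of u 0] by (simp add: \<alpha>_def)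
      qed
      show "\<rho> x < \<rho> (g x)" if x: "x \<in> L \<union> B \<union> (h ` V \<union> A)" for x
      proof (cases "x \<in> A'")
        case True
        then have "g x \<in> A" using g_img_A by blast
        then show ?thesis using True A_A' by (auto simp: \<rho>_def)
      next
        case False
        then have xQ: "x \<in> \<Omega> - P - A'" using x unfolding Q by blast
        then have gx: "g x \<in> h ` V" using g_img_Q by blast
        then have "g x \<notin> A'" "g x \<notin> A" using hVA hV by auto
        then have "\<rho> (g x) = r (g x) + 2" by (simp add: \<rho>_def)
        moreover have "r x < r (g x)"
          using g_Q[OF xQ] r(3)[of x 1] xQ by (simp add: \<beta>_def)
        ultimately show ?thesis by (simp add: \<rho>_def)
      qed
    qed
  qed
  have KL: "K \<approx> \<Omega>" "L \<approx> \<Omega>"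
  proof -
    have large: "X \<approx> \<Omega>" if "M \<subseteq> X" "X \<subseteq> \<Omega>" for X
    proof (rule lepoll_antisym)
      show "X \<lesssim> \<Omega>" using that(2) by (rule subset_imp_lepoll)
      show "\<Omega> \<lesssim> X" using that(1) inj_\<sigma>[of 3] by (auto simp: lepoll_def M_def)
    qed
    show "K \<approx> \<Omega>" using MP MV MA sub by (intro large) (auto simp: K_def)
    show "L \<approx> \<Omega>" using MP hVM M\<Omega> sub A\<Omega> B\<Omega> by (intro large) (auto simp: L_def)
  qed
  have A'A: "A' \<approx> A"
    unfolding A'_def using inj_2 A\<Omega>(1) by (intro inj_on_image_eqpoll_self) (rule inj_on_subset)
  have f_into: "f ` \<Omega> \<subseteq> \<Omega>"
  proof -
    have "\<Omega> = V \<union> (\<Omega> - V)" using sub by blast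
    then have "f ` \<Omega> = (\<Omega> - P - A') \<union> P" using f_img_V f_img_U by (metis image_Un)
    then show ?thesis using sub by blast
  qed
  have "h x = g (f x)" if x: "x \<in> \<Omega>" for x
  proof (cases "x \<in> V")
    case True
    then obtain y where "y \<in> \<Omega> - P - A'" "x = \<beta> y" by (auto simp: V_def)
    then show ?thesis using f_V[of y] g_Q[of y] by simp
  next
    case False
    then show ?thesis using x f_U[of x] g_P[of x] by simp
  qed
  then show thesis
    by (rule that[OF inj_f f_into _ f_cycles A'A KL(1) g_cycles KL(2)])
qed

section \<open>Conjugates in the monoid of injections\<close>

lemma Inj_conj_apply:
  assumes f: "f \<in> carrier (Inj \<Omega>)" and a: "a \<in> Bij \<Omega>" and x: "x \<in> \<Omega>"
  shows "(a \<otimes>\<^bsub>Inj \<Omega>\<^esub> f \<otimes>\<^bsub>Inj \<Omega>\<^esub> inv\<^bsub>Inj \<Omega>\<^esub> a) x = inv_into \<Omega> a (f (a x))"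
proof -
  have "a x \<in> \<Omega>" using a x by (auto simp: Bij_def bij_betw_def)
  moreover from this have "f (a x) \<in> \<Omega>" using f by (auto simp: carrier_Inj)
  ultimately show ?thesis using x by (simp add: mult_Inj inv_Inj[OF a] compose_eq)
qed

lemma Inj_conj_closed:
  assumes "f \<in> carrier (Inj \<Omega>)" "a \<in> Bij \<Omega>"
  shows "a \<otimes>\<^bsub>Inj \<Omega>\<^esub> f \<otimes>\<^bsub>Inj \<Omega>\<^esub> inv\<^bsub>Inj \<Omega>\<^esub> a \<in> carrier (Inj \<Omega>)"
  using assms Bij_inverse_Inj[OF assms(2)]
  by (simp add: inv_Inj monoid.m_closed[OF monoid_Inj])

lemma Inj_conj_prod:
  assumes f: "f \<in> carrier (Inj \<Omega>)" and a: "a \<in> Bij \<Omega>" and b: "b \<in> Bij \<Omega>"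
  shows "a \<otimes>\<^bsub>Inj \<Omega>\<^esub> f \<otimes>\<^bsub>Inj \<Omega>\<^esub> inv\<^bsub>Inj \<Omega>\<^esub> a \<otimes>\<^bsub>Inj \<Omega>\<^esub> b \<otimes>\<^bsub>Inj \<Omega>\<^esub> f \<otimes>\<^bsub>Inj \<Omega>\<^esub> inv\<^bsub>Inj \<Omega>\<^esub> b
    = (a \<otimes>\<^bsub>Inj \<Omega>\<^esub> f \<otimes>\<^bsub>Inj \<Omega>\<^esub> inv\<^bsub>Inj \<Omega>\<^esub> a) \<otimes>\<^bsub>Inj \<Omega>\<^esub> (b \<otimes>\<^bsub>Inj \<Omega>\<^esub> f \<otimes>\<^bsub>Inj \<Omega>\<^esub> inv\<^bsub>Inj \<Omega>\<^esub> b)"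
  using f Bij_inverse_Inj[OF a] Bij_inverse_Inj[OF b]
  by (simp add: inv_Inj[OF a] inv_Inj[OF b] monoid.m_closed[OF monoid_Inj] monoid.m_assoc[OF monoid_Inj])

lemma conj_defect:
  assumes f: "f \<in> carrier (Inj \<Omega>)" and a: "a \<in> Bij \<Omega>"
  shows "\<Omega> - (a \<otimes>\<^bsub>Inj \<Omega>\<^esub> f \<otimes>\<^bsub>Inj \<Omega>\<^esub> inv\<^bsub>Inj \<Omega>\<^esub> a) ` \<Omega> \<approx> \<Omega> - f ` \<Omega>"
proof -
  let ?c = "inv_into \<Omega> a"
  have a': "bij_betw a \<Omega> \<Omega>" using a by (simp add: Bij_def)
  then have c: "bij_betw ?c \<Omega> \<Omega>" by (rule bij_betw_inv_into)
  have f': "f ` \<Omega> \<subseteq> \<Omega>" using f by (auto simp: carrier_Inj)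
  have "(a \<otimes>\<^bsub>Inj \<Omega>\<^esub> f \<otimes>\<^bsub>Inj \<Omega>\<^esub> inv\<^bsub>Inj \<Omega>\<^esub> a) ` \<Omega> = (\<lambda>x. ?c (f (a x))) ` \<Omega>"
    using Inj_conj_apply[OF f a] by (intro image_cong) auto
  also have "\<dots> = ?c ` f ` a ` \<Omega>" by (simp add: image_image)
  also have "\<dots> = ?c ` f ` \<Omega>" using a' by (simp add: bij_betw_def)
  finally have "\<Omega> - (a \<otimes>\<^bsub>Inj \<Omega>\<^esub> f \<otimes>\<^bsub>Inj \<Omega>\<^esub> inv\<^bsub>Inj \<Omega>\<^esub> a) ` \<Omega> = ?c ` \<Omega> - ?c ` f ` \<Omega>"
    using c by (simp add: bij_betw_def)
  also have "\<dots> = ?c ` (\<Omega> - f ` \<Omega>)"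
    using c f' by (simp add: bij_betw_def inj_on_image_set_diff[of ?c \<Omega>])
  also have "\<dots> \<approx> \<Omega> - f ` \<Omega>"
    using c by (intro inj_on_image_eqpoll_self) (auto simp: bij_betw_def intro: inj_on_subset)
  finally show ?thesis .
qed

lemma mult_defect:
  assumes f: "f \<in> carrier (Inj \<Omega>)" and g: "g \<in> carrier (Inj \<Omega>)"
  shows "\<Omega> - (f \<otimes>\<^bsub>Inj \<Omega>\<^esub> g) ` \<Omega> = (\<Omega> - g ` \<Omega>) \<union> g ` (\<Omega> - f ` \<Omega>)"
proof -
  have "f ` \<Omega> \<subseteq> \<Omega>" "g ` \<Omega> \<subseteq> \<Omega>" "inj_on g \<Omega>" using f g by (auto simp: carrier_Inj)
  moreover have "(f \<otimes>\<^bsub>Inj \<Omega>\<^esub> g) ` \<Omega> = g ` f ` \<Omega>"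
    by (auto simp: mult_Inj compose_eq image_image)
  ultimately show ?thesis by (auto simp: inj_on_image_set_diff[of g \<Omega>])
qed

lemma defect_of_product_of_conjugates:
  assumes f: "f \<in> carrier (Inj \<Omega>)" and a: "a \<in> Bij \<Omega>" and b: "b \<in> Bij \<Omega>"
    and h: "h = a \<otimes>\<^bsub>Inj \<Omega>\<^esub> f \<otimes>\<^bsub>Inj \<Omega>\<^esub> inv\<^bsub>Inj \<Omega>\<^esub> a \<otimes>\<^bsub>Inj \<Omega>\<^esub> b \<otimes>\<^bsub>Inj \<Omega>\<^esub> f \<otimes>\<^bsub>Inj \<Omega>\<^esub> inv\<^bsub>Inj \<Omega>\<^esub> b"
    and fin: "finite (\<Omega> - h ` \<Omega>)"
  shows "even (card (\<Omega> - h ` \<Omega>))"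
proof -
  define f1 where "f1 = a \<otimes>\<^bsub>Inj \<Omega>\<^esub> f \<otimes>\<^bsub>Inj \<Omega>\<^esub> inv\<^bsub>Inj \<Omega>\<^esub> a"
  define f2 where "f2 = b \<otimes>\<^bsub>Inj \<Omega>\<^esub> f \<otimes>\<^bsub>Inj \<Omega>\<^esub> inv\<^bsub>Inj \<Omega>\<^esub> b"
  have f1: "f1 \<in> carrier (Inj \<Omega>)" and f2: "f2 \<in> carrier (Inj \<Omega>)"
    using Inj_conj_closed f a b by (simp_all add: f1_def f2_def)
  have "h = f1 \<otimes>\<^bsub>Inj \<Omega>\<^esub> f2" unfolding h f1_def f2_def by (rule Inj_conj_prod[OF f a b])
  then have D: "\<Omega> - h ` \<Omega> = (\<Omega> - f2 ` \<Omega>) \<union> f2 ` (\<Omega> - f1 ` \<Omega>)"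
    using mult_defect[OF f1 f2] by simp
  have "f2 ` (\<Omega> - f1 ` \<Omega>) \<approx> \<Omega> - f1 ` \<Omega>"
    using f2 by (intro inj_on_image_eqpoll_self) (auto simp: carrier_Inj intro: inj_on_subset)
  also have "\<dots> \<approx> \<Omega> - f ` \<Omega>" unfolding f1_def by (rule conj_defect[OF f a])
  also have "\<dots> \<approx> \<Omega> - f2 ` \<Omega>" unfolding f2_def by (rule eqpoll_sym[OF conj_defect[OF f b]])
  finally have "card (f2 ` (\<Omega> - f1 ` \<Omega>)) = card (\<Omega> - f2 ` \<Omega>)"
    using fin unfolding D by (simp add: eqpoll_iff_card)
  moreover have "card (\<Omega> - h ` \<Omega>) = card (\<Omega> - f2 ` \<Omega>) + card (f2 ` (\<Omega> - f1 ` \<Omega>))"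
    unfolding D using fin unfolding D by (intro card_Un_disjoint) auto
  ultimately show ?thesis by simp
qed

section \<open>Products of two conjugates\<close>

theorem corollary15:
  fixes \<Omega> :: "'a set" and h :: "'a \<Rightarrow> 'a"
  assumes "infinite \<Omega>" and "h \<in> carrier (Inj \<Omega>)"
  shows "(\<exists>f \<in> carrier (Inj \<Omega>). \<exists>a \<in> Bij \<Omega>. \<exists>b \<in> Bij \<Omega>.
            h = a \<otimes>\<^bsub>Inj \<Omega>\<^esub> f \<otimes>\<^bsub>Inj \<Omega>\<^esub> inv\<^bsub>Inj \<Omega>\<^esub> a \<otimes>\<^bsub>Inj \<Omega>\<^esub> b \<otimes>\<^bsub>Inj \<Omega>\<^esub> f \<otimes>\<^bsub>Inj \<Omega>\<^esub> inv\<^bsub>Inj \<Omega>\<^esub> b)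
         \<longleftrightarrow> even (card (\<Omega> - h ` \<Omega>)) \<or> infinite (\<Omega> - h ` \<Omega>)"
  (is "?factors \<longleftrightarrow> ?even_or_infinite")
proof
  assume ?factors
  then show ?even_or_infinite using defect_of_product_of_conjugates by blast
next
  assume ?even_or_infinite
  then obtain A B where AB: "\<Omega> - h ` \<Omega> = A \<union> B" "A \<inter> B = {}" "A \<approx> B"
    using even_card_halves infinite_halves by metis
  have h: "inj_on h \<Omega>" "h ` \<Omega> \<subseteq> \<Omega>" "h \<in> extensional \<Omega>"
    using assms(2) by (auto simp: carrier_Inj PiE_iff)
  obtain f g K L A' where f: "inj_on f \<Omega>" "f ` \<Omega> \<subseteq> \<Omega>"
    and hgf: "\<And>x. x \<in> \<Omega> \<Longrightarrow> h x = g (f x)"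
    and cf: "infinite_cycles \<Omega> f K A'" "A' \<approx> A" "K \<approx> \<Omega>"
    and cg: "infinite_cycles \<Omega> g L B" "L \<approx> \<Omega>"
    by (rule factor_into_infinite_cycles[OF assms(1) h(1,2) AB(1,2)]) blast
  have "L \<approx> K" "B \<approx> A'"
    using cf cg AB(3) eqpoll_sym eqpoll_trans by blast+
  then obtain b where b: "bij_betw b \<Omega> \<Omega>" and bg: "\<And>x. x \<in> \<Omega> \<Longrightarrow> b (g x) = f (b x)"
    using infinite_cycles_conjugate[OF cg(1) cf(1)] by blast
  define F where "F = restrict f \<Omega>"
  define b' where "b' = restrict b \<Omega>"
  \<comment> \<open>The first factor is \<open>f\<close> itself, so it is conjugated by the identity \<open>i\<close>.\<close>
  define i where "i = (\<lambda>x\<in>\<Omega>. x)"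
  have F: "F \<in> carrier (Inj \<Omega>)"
    using f by (auto simp: F_def carrier_Inj inj_on_def)
  have b': "b' \<in> Bij \<Omega>" using b by (simp add: b'_def Bij_def bij_betw_restrict_eq)
  have i: "i \<in> Bij \<Omega>" by (simp add: i_def id_Bij)
  let ?conj = "\<lambda>c. c \<otimes>\<^bsub>Inj \<Omega>\<^esub> F \<otimes>\<^bsub>Inj \<Omega>\<^esub> inv\<^bsub>Inj \<Omega>\<^esub> c"
  have "h = ?conj i \<otimes>\<^bsub>Inj \<Omega>\<^esub> ?conj b'"
  proof (rule extensionalityI[OF h(3)])
    show "?conj i \<otimes>\<^bsub>Inj \<Omega>\<^esub> ?conj b' \<in> extensional \<Omega>"
      by (simp add: mult_Inj)
    fix x assume x: "x \<in> \<Omega>"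
    have fx: "f x \<in> \<Omega>" using f x by blast
    have "inv_into \<Omega> i (i (f x)) = f x"
      using i fx by (intro inv_into_f_f) (auto simp: Bij_def bij_betw_def)
    then have ci: "?conj i x = f x"
      using Inj_conj_apply[OF F i x] x fx by (simp add: i_def F_def)
    have "b (f x) \<in> \<Omega>" using b fx by (rule bij_betw_apply)
    then have "?conj b' (f x) = inv_into \<Omega> b' (f (b (f x)))"
      using Inj_conj_apply[OF F b' fx] fx by (simp add: b'_def F_def)
    also have "f (b (f x)) = b' (h x)"
      using bg[OF fx] hgf[OF x] h(2) x by (auto simp: b'_def)
    also have "inv_into \<Omega> b' (b' (h x)) = h x"
      using b' h(2) x by (intro inv_into_f_f) (auto simp: Bij_def bij_betw_def)
    finally show "h x = (?conj i \<otimes>\<^bsub>Inj \<Omega>\<^esub> ?conj b') x"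
      using x ci by (simp add: mult_Inj[of _ "?conj i"] compose_eq)
  qed
  then show ?factors
    unfolding Inj_conj_prod[OF F i b', symmetric] using F i b' by blast
qed

end
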